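(* Let $\tilde{\mathfrak g}$ be the $5$-dimensional real Lie algebra with basis $\{e_1,\dots,e_5\}$ whose nonzero brackets (up to antisymmetry) are $$[e_1,e_2]=-e_3,\quad [e_4,e_2]=-e_1,\quad [e_4,e_1]=e_2,\quad [e_5,e_1]=-e_1+e_3,$$ $$[e_5,e_2]=-e_2,\quad [e_5,e_3]=-2e_3,\quad [e_5,e_4]=e_1+\tfrac{7}{12}e_3,$$ and let $\tilde g$ be the symmetric bilinear form on $\tilde{\mathfrak g}$ whose only nonzero components $\tilde g_{ij}=\tilde g(e_i,e_j)$ are $$\tilde g_{11}=\tfrac{497}{576},\quad \tilde g_{22}=\tfrac{49}{192},\quad \tilde g_{33}=2,\quad \tilde g_{13}=\tilde g_{31}=-\tfrac{7}{6},\quad \tilde g_{44}=-\tfrac{245}{6144},\quad \tilde g_{55}=-\tfrac{1225}{6144}.$$ Let $\mathfrak n$ be the nilradical of $\tilde{\mathfrak g}$ and let $\hat g$ be the restriction of $\tilde g$ to $\mathfrak n$. Then $\hat g$ is a Riemannian (i.e. positive definite) metric on $\mathfrak n$; in particular, $\hat g$ is nondegenerate.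
   Context: The nilradical of a Lie algebra is its maximal nilpotent ideal. A left-invariant metric is identified with a symmetric bilinear form on the Lie algebra; it is called Riemannian if it is positive definite. *)

theory Defs
  imports "HOL-Analysis.Analysis"
begin

definition lie_bracket :: "('a::real_vector \<Rightarrow> 'a \<Rightarrow> 'a) \<Rightarrow> bool" where
  "lie_bracket br \<longleftrightarrow>
     bilinear br \<and> (\<forall>x. br x x = 0) \<and>
     (\<forall>x y z. br x (br y z) + br y (br z x) + br z (br x y) = 0)"

definition lie_ideal :: "('a::real_vector \<Rightarrow> 'a \<Rightarrow> 'a) \<Rightarrow> 'a set \<Rightarrow> bool" where
  "lie_ideal br I \<longleftrightarrow> subspace I \<and> (\<forall>x. \<forall>y\<in>I. br x y \<in> I)"

text \<open>The lower central series of a subalgebra \<open>N\<close>, regarded as a Lie algebra in its own right.\<close>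

primrec lower_central_series ::
    "('a::real_vector \<Rightarrow> 'a \<Rightarrow> 'a) \<Rightarrow> 'a set \<Rightarrow> nat \<Rightarrow> 'a set" where
  "lower_central_series br N 0 = N"
| "lower_central_series br N (Suc k) =
     span {br x y | x y. x \<in> N \<and> y \<in> lower_central_series br N k}"

definition lie_nilpotent :: "('a::real_vector \<Rightarrow> 'a \<Rightarrow> 'a) \<Rightarrow> 'a set \<Rightarrow> bool" where
  "lie_nilpotent br N \<longleftrightarrow> (\<exists>k. lower_central_series br N k = {0})"

definition nilpotent_ideal :: "('a::real_vector \<Rightarrow> 'a \<Rightarrow> 'a) \<Rightarrow> 'a set \<Rightarrow> bool" where
  "nilpotent_ideal br N \<longleftrightarrow> lie_ideal br N \<and> lie_nilpotent br N"

text \<open>Maximal means maximal with respect to inclusion. The description is proper for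
  finite-dimensional Lie algebras, where the sum of two nilpotent ideals is a nilpotent ideal,
  so that exactly one maximal nilpotent ideal exists.\<close>

definition nilradical :: "('a::real_vector \<Rightarrow> 'a \<Rightarrow> 'a) \<Rightarrow> 'a set" where
  "nilradical br =
     (THE N. nilpotent_ideal br N \<and> (\<forall>J. nilpotent_ideal br J \<and> N \<subseteq> J \<longrightarrow> J = N))"

text \<open>The following three predicates only depend on the values of \<open>g\<close> on \<open>V\<close>, that is, on the
  restriction of \<open>g\<close> to \<open>V\<close>.\<close>

definition symmetric_bilinear_form_on ::
    "'a::real_vector set \<Rightarrow> ('a \<Rightarrow> 'a \<Rightarrow> real) \<Rightarrow> bool" where
  "symmetric_bilinear_form_on V g \<longleftrightarrow>
     subspace V \<and>
     (\<forall>x\<in>V. \<forall>y\<in>V. g x y = g y x) \<and>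
     (\<forall>x\<in>V. \<forall>y\<in>V. \<forall>z\<in>V. g (x + y) z = g x z + g y z) \<and>
     (\<forall>c. \<forall>x\<in>V. \<forall>y\<in>V. g (c *\<^sub>R x) y = c * g x y)"

definition riemannian_on :: "'a::real_vector set \<Rightarrow> ('a \<Rightarrow> 'a \<Rightarrow> real) \<Rightarrow> bool" where
  "riemannian_on V g \<longleftrightarrow>
     symmetric_bilinear_form_on V g \<and> (\<forall>x\<in>V. x \<noteq> 0 \<longrightarrow> g x x > 0)"

definition nondegenerate_on :: "'a::real_vector set \<Rightarrow> ('a \<Rightarrow> 'a \<Rightarrow> real) \<Rightarrow> bool" where
  "nondegenerate_on V g \<longleftrightarrow> (\<forall>x\<in>V. (\<forall>y\<in>V. g x y = 0) \<longrightarrow> x = 0)"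

text \<open>The underlying space is \<open>real ^ 5\<close> with its standard basis. In the index type \<open>5\<close> the numeral
  \<open>5\<close> equals \<open>0\<close>, so \<open>1, \<dots>, 5\<close> are its five distinct elements.\<close>

abbreviation E :: "5 \<Rightarrow> real ^ 5" where
  "E i \<equiv> axis i 1"

text \<open>Only one order of each pair is listed; the other one comes from the
  antisymmetrisation in \<open>tilde_bracket\<close>.\<close>

definition bracket_table :: "5 \<Rightarrow> 5 \<Rightarrow> real ^ 5" where
  "bracket_table i j =
     (if (i, j) = (1, 2) then - E 3
      else if (i, j) = (4, 2) then - E 1
      else if (i, j) = (4, 1) then E 2
      else if (i, j) = (5, 1) then - E 1 + E 3
      else if (i, j) = (5, 2) then - E 2
      else if (i, j) = (5, 3) then - 2 *\<^sub>R E 3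
      else if (i, j) = (5, 4) then E 1 + (7 / 12) *\<^sub>R E 3
      else 0)"

definition tilde_bracket :: "real ^ 5 \<Rightarrow> real ^ 5 \<Rightarrow> real ^ 5" where
  "tilde_bracket x y =
     (\<Sum>i\<in>UNIV. \<Sum>j\<in>UNIV. (x $ i * y $ j) *\<^sub>R (bracket_table i j - bracket_table j i))"

definition metric_table :: "5 \<Rightarrow> 5 \<Rightarrow> real" where
  "metric_table i j =
     (if (i, j) = (1, 1) then 497 / 576
      else if (i, j) = (2, 2) then 49 / 192
      else if (i, j) = (3, 3) then 2
      else if (i, j) = (1, 3) \<or> (i, j) = (3, 1) then - 7 / 6
      else if (i, j) = (4, 4) then - 245 / 6144
      else if (i, j) = (5, 5) then - 1225 / 6144
      else 0)"

definition tilde_metric :: "real ^ 5 \<Rightarrow> real ^ 5 \<Rightarrow> real" where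
  "tilde_metric x y = (\<Sum>i\<in>UNIV. \<Sum>j\<in>UNIV. x $ i * y $ j * metric_table i j)"

lemma UNIV_5: "(UNIV :: 5 set) = {1, 2, 3, 4, 5}"
proof -
  have "card {1, 2, 3, 4, 5 :: 5} = CARD(5)"
    by simp
  then show ?thesis
    by (metis card_subset_eq finite subset_UNIV)
qed

lemma sum_5: "sum f (UNIV :: 5 set) = f 1 + f 2 + f 3 + f 4 + f 5"
  for f :: "5 \<Rightarrow> 'a::comm_monoid_add"
  unfolding UNIV_5 by (simp add: ac_simps)

lemma forall_5: "(\<forall>i::5. P i) \<longleftrightarrow> P 1 \<and> P 2 \<and> P 3 \<and> P 4 \<and> P 5"
proof -
  have "(\<forall>i::5. P i) \<longleftrightarrow> (\<forall>i\<in>UNIV. P i)"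
    by simp
  then show ?thesis
    unfolding UNIV_5 by (simp del: ball_UNIV)
qed

lemma tilde_bracket_basis: "tilde_bracket (E i) (E j) = bracket_table i j - bracket_table j i"
proof -
  have "tilde_bracket (E i) (E j) =
      (\<Sum>k\<in>UNIV. \<Sum>l\<in>UNIV. if k = i then if l = j then bracket_table k l - bracket_table l k else 0 else 0)"
    unfolding tilde_bracket_def by (intro sum.cong refl) (auto simp: axis_def)
  also have "\<dots> = (\<Sum>k\<in>UNIV. if k = i then (\<Sum>l\<in>UNIV. if l = j then bracket_table k l - bracket_table l k else 0) else 0)"
    by (intro sum.cong refl) auto
  finally show ?thesis
    by simp
qed

lemma tilde_bracket_components:
  "tilde_bracket x y $ 1 = x $ 2 * y $ 4 - x $ 4 * y $ 2 + x $ 1 * y $ 5 - x $ 5 * y $ 1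
     + x $ 5 * y $ 4 - x $ 4 * y $ 5"
  "tilde_bracket x y $ 2 = x $ 4 * y $ 1 - x $ 1 * y $ 4 + x $ 2 * y $ 5 - x $ 5 * y $ 2"
  "tilde_bracket x y $ 3 = x $ 2 * y $ 1 - x $ 1 * y $ 2 + x $ 5 * y $ 1 - x $ 1 * y $ 5
     + 2 * (x $ 3 * y $ 5 - x $ 5 * y $ 3) + 7 / 12 * (x $ 5 * y $ 4 - x $ 4 * y $ 5)"
  "tilde_bracket x y $ 4 = 0"
  "tilde_bracket x y $ 5 = 0"
  unfolding tilde_bracket_def sum_5 bracket_table_def axis_def
  by simp_all

lemma lie_bracket_tilde_bracket: "lie_bracket tilde_bracket"
  unfolding lie_bracket_def
proof (intro conjI allI)
  show "bilinear tilde_bracket"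
    unfolding bilinear_def
    by (intro conjI allI linearI)
       (simp_all add: vec_eq_iff forall_5 tilde_bracket_components algebra_simps)
next
  fix x
  show "tilde_bracket x x = 0"
    by (simp add: vec_eq_iff forall_5 tilde_bracket_components algebra_simps)
next
  fix x y z
  show "tilde_bracket x (tilde_bracket y z) + tilde_bracket y (tilde_bracket z x)
      + tilde_bracket z (tilde_bracket x y) = 0"
    by (simp add: vec_eq_iff forall_5 tilde_bracket_components algebra_simps)
qed

end

theory Submission
  imports Defs
begin

text \<open>The nilradical is the ideal spanned by the first three basis vectors. This ideal is a
  Heisenberg algebra, hence nilpotent. It contains every other nilpotent ideal, because an element
  \<open>x\<close> with \<open>(x\<^sub>4, x\<^sub>5) \<noteq> (0, 0)\<close> acts on the plane of \<open>e\<^sub>1, e\<^sub>2\<close> modulo \<open>e\<^sub>3\<close> as multiplication by the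
  nonzero complex number \<open>-x\<^sub>5 + \<i> x\<^sub>4\<close>. So iterating \<open>[x, _]\<close> never kills a vector that is nonzero
  in that plane, and an ideal that contains \<open>x\<close> has a lower central series that never vanishes.
  On the Heisenberg ideal the metric is a sum of squares with positive coefficients, after
  completing the square in the third coordinate; the two negative diagonal entries belong to
  \<open>e\<^sub>4\<close> and \<open>e\<^sub>5\<close>.\<close>

lemma nilradical_eqI:
  assumes "nilpotent_ideal br N" and "\<And>J. nilpotent_ideal br J \<Longrightarrow> J \<subseteq> N"
  shows "nilradical br = N"
  unfolding nilradical_def
  by (rule the_equality) (use assms in blast)+

text \<open>This is how a single element \<open>x\<close> obstructs nilpotency: if \<open>[x, _]\<close> has arbitrarily long nonzero
  orbits in \<open>N\<close>, then no term of the series vanishes.\<close>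

lemma funpow_in_lower_central_series:
  assumes "x \<in> N" "z \<in> N"
  shows "(br x ^^ k) z \<in> lower_central_series br N k"
proof (induction k)
  case (Suc k)
  then show ?case
    using assms(1) by (auto intro!: span_base)
qed (use assms(2) in simp)

definition heisenberg_ideal :: "(real ^ 5) set" where
  "heisenberg_ideal = {x. x $ 4 = 0 \<and> x $ 5 = 0}"

lemma heisenberg_ideal_lie_ideal: "lie_ideal tilde_bracket heisenberg_ideal"
  by (auto simp: lie_ideal_def subspace_def heisenberg_ideal_def tilde_bracket_components)

text \<open>Two brackets suffice: the first lands in the line of \<open>e\<^sub>3\<close>, which is central in the ideal.\<close>

lemma heisenberg_ideal_nilpotent: "lie_nilpotent tilde_bracket heisenberg_ideal"
proof -
  let ?L = "lower_central_series tilde_bracket heisenberg_ideal"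
  let ?C = "{x :: real ^ 5. x $ 1 = 0 \<and> x $ 2 = 0 \<and> x $ 4 = 0 \<and> x $ 5 = 0}"
  have "?L 1 \<subseteq> ?C"
    unfolding One_nat_def lower_central_series.simps
    by (rule span_minimal) (auto simp: subspace_def heisenberg_ideal_def tilde_bracket_components)
  then have "tilde_bracket x y = 0" if "x \<in> heisenberg_ideal" "y \<in> ?L 1" for x y
    using that
    by (auto simp: vec_eq_iff forall_5 tilde_bracket_components heisenberg_ideal_def)
  then have "?L (Suc 1) \<subseteq> {0}"
    unfolding lower_central_series.simps(2)[of _ _ 1]
    by (intro span_minimal) auto
  moreover have "0 \<in> ?L (Suc 1)"
    by (simp add: span_zero)
  ultimately show ?thesis
    unfolding lie_nilpotent_def by blast
qed

text \<open>The identity behind the recursion is the multiplicativity of the complex modulus,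
  \<open>\<bar>(-x\<^sub>5 + \<i> x\<^sub>4) (z\<^sub>1 + \<i> z\<^sub>2)\<bar>\<^sup>2 = (x\<^sub>4\<^sup>2 + x\<^sub>5\<^sup>2) (z\<^sub>1\<^sup>2 + z\<^sub>2\<^sup>2)\<close>.\<close>

lemma norm_funpow_tilde_bracket:
  assumes "z \<in> heisenberg_ideal"
  shows "(tilde_bracket x ^^ k) z \<in> heisenberg_ideal"
    and "((tilde_bracket x ^^ k) z $ 1)\<^sup>2 + ((tilde_bracket x ^^ k) z $ 2)\<^sup>2
       = ((x $ 4)\<^sup>2 + (x $ 5)\<^sup>2) ^ k * ((z $ 1)\<^sup>2 + (z $ 2)\<^sup>2)"
proof (induction k)
  case (Suc k)
  define w where "w = (tilde_bracket x ^^ k) z"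
  have w: "w $ 4 = 0" "w $ 5 = 0"
    using Suc(1) by (simp_all add: w_def heisenberg_ideal_def)
  {
    case 1
    show ?case
      by (simp add: heisenberg_ideal_def tilde_bracket_components)
  next
    case 2
    have "(tilde_bracket x w $ 1)\<^sup>2 + (tilde_bracket x w $ 2)\<^sup>2
        = ((x $ 4)\<^sup>2 + (x $ 5)\<^sup>2) * ((w $ 1)\<^sup>2 + (w $ 2)\<^sup>2)"
      by (simp add: tilde_bracket_components w power2_eq_square algebra_simps)
    then show ?case
      using Suc(2) by (simp add: w_def)
  }
qed (use assms in simp_all)

text \<open>The iteration starts at \<open>[e\<^sub>1, x]\<close>, which lies in the ideal \<open>J\<close> whether or not \<open>e\<^sub>1\<close> does,
  and whose image in the plane is nonzero if \<open>(x\<^sub>4, x\<^sub>5) \<noteq> (0, 0)\<close>.\<close>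

lemma nilpotent_ideal_subset_heisenberg_ideal:
  assumes "nilpotent_ideal tilde_bracket J"
  shows "J \<subseteq> heisenberg_ideal"
proof
  fix x
  assume x: "x \<in> J"
  have ideal: "lie_ideal tilde_bracket J"
    using assms by (simp add: nilpotent_ideal_def)
  obtain k where k: "lower_central_series tilde_bracket J k = {0}"
    using assms by (auto simp: nilpotent_ideal_def lie_nilpotent_def)
  define z where "z = tilde_bracket (E 1) x"
  have z_J: "z \<in> J"
    using ideal x by (simp add: lie_ideal_def z_def)
  have z_H: "z \<in> heisenberg_ideal"
    by (simp add: z_def heisenberg_ideal_def tilde_bracket_components)
  have z_norm: "(z $ 1)\<^sup>2 + (z $ 2)\<^sup>2 = (x $ 4)\<^sup>2 + (x $ 5)\<^sup>2"
    by (simp add: z_def tilde_bracket_components axis_def)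
  have "(tilde_bracket x ^^ k) z = 0"
    using funpow_in_lower_central_series[OF x z_J, where br = tilde_bracket and k = k] k by simp
  then have "((x $ 4)\<^sup>2 + (x $ 5)\<^sup>2) ^ Suc k = 0"
    using norm_funpow_tilde_bracket(2)[OF z_H, where x = x and k = k] z_norm by (simp add: mult.commute)
  then have "(x $ 4)\<^sup>2 + (x $ 5)\<^sup>2 = 0"
    by (simp only: power_eq_0_iff)
  then show "x \<in> heisenberg_ideal"
    by (simp add: heisenberg_ideal_def sum_power2_eq_zero_iff)
qed

lemma nilradical_tilde_bracket: "nilradical tilde_bracket = heisenberg_ideal"
  by (rule nilradical_eqI)
     (simp_all add: nilpotent_ideal_def heisenberg_ideal_lie_ideal heisenberg_ideal_nilpotent
       nilpotent_ideal_subset_heisenberg_ideal[unfolded nilpotent_ideal_def])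

lemma tilde_metric_heisenberg_ideal:
  assumes "x \<in> heisenberg_ideal"
  shows "tilde_metric x x
       = 2 * (x $ 3 - 7 / 12 * x $ 1)\<^sup>2 + 35 / 192 * (x $ 1)\<^sup>2 + 49 / 192 * (x $ 2)\<^sup>2"
  using assms
  by (simp add: tilde_metric_def sum_5 metric_table_def heisenberg_ideal_def
      power2_eq_square algebra_simps)

lemma tilde_metric_heisenberg_ideal_pos:
  assumes "x \<in> heisenberg_ideal" "x \<noteq> 0"
  shows "tilde_metric x x > 0"
proof (rule ccontr)
  assume "\<not> tilde_metric x x > 0"
  then have le: "2 * (x $ 3 - 7 / 12 * x $ 1)\<^sup>2 + 35 / 192 * (x $ 1)\<^sup>2 + 49 / 192 * (x $ 2)\<^sup>2 \<le> 0"
    using tilde_metric_heisenberg_ideal[OF assms(1)] by simp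
  have nonneg: "(x $ 3 - 7 / 12 * x $ 1)\<^sup>2 \<ge> 0" "(x $ 1)\<^sup>2 \<ge> 0" "(x $ 2)\<^sup>2 \<ge> 0"
    by simp_all
  have "(x $ 3 - 7 / 12 * x $ 1)\<^sup>2 = 0" "(x $ 1)\<^sup>2 = 0" "(x $ 2)\<^sup>2 = 0"
    using le nonneg by linarith+
  then have "x = 0"
    using assms(1) by (simp add: vec_eq_iff forall_5 heisenberg_ideal_def)
  with assms(2) show False ..
qed

lemma riemannian_on_imp_nondegenerate_on: "riemannian_on V g \<Longrightarrow> nondegenerate_on V g"
  unfolding riemannian_on_def nondegenerate_on_def by (metis less_irrefl)

theorem lemma4p2:
  shows "riemannian_on (nilradical tilde_bracket) tilde_metric
       \<and> nondegenerate_on (nilradical tilde_bracket) tilde_metric"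
proof -
  have "symmetric_bilinear_form_on heisenberg_ideal tilde_metric"
    using heisenberg_ideal_lie_ideal
    by (simp add: symmetric_bilinear_form_on_def lie_ideal_def tilde_metric_def sum_5
        metric_table_def algebra_simps)
  then have "riemannian_on heisenberg_ideal tilde_metric"
    by (simp add: riemannian_on_def tilde_metric_heisenberg_ideal_pos)
  then show ?thesis
    by (simp add: nilradical_tilde_bracket riemannian_on_imp_nondegenerate_on)
qed

end
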